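(* There is a left-linear monadic TRS $R$ over a ranked alphabet $\Sigma$ such that $R$ is an EPRF-TRS and $R$ is not a P$\Sigma$R-TRS.
   Context: A ranked alphabet $\Sigma$ is a finite set of symbols with ranks; $X$ a countable set of variables, $T_\Sigma(X)$ the terms, $T_\Sigma$ the ground terms; the height of a variable or constant is $0$. A TRS $R$ over $\Sigma$ is a finite set of rules $l\to r$, $l,r\in T_\Sigma(X)$, with every variable of $r$ occurring in $l$; $sign(R)$ is the set of symbols in its rules; left-linear if no variable occurs twice in a left-hand side; monadic if each left-hand side has height at least $1$ and each right-hand side has height at most $1$. $R^*_\Sigma(L)=\{p\mid q\Rightarrow^*_R p,\ q\in L\}$. A bottom-up tree automaton (bta) over $\Sigma$ is a finite automaton with states (treated as constants), final states, rules $\delta(a_1,\dots,a_n)\to a$ and $a\to a'$, recognizing the ground terms rewriting to a final state; recognizable = recognized by some bta. $R$ is a P$\Sigma$R-TRS if $R^*_\Sigma(L)$ is recognizable for every recognizable $L\subseteq T_\Sigma$. $R$ is an EPRF-TRS if for any given ranked alphabet $\Sigma'\supseteq sign(R)$ and finite $L\subseteq T_{\Sigma'}$ one can effectively construct a bta $\mathcal{C}$ over $\Sigma'$ with $L(\mathcal{C})=R^*_{\Sigma'}(L)$. *)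

theory Defs
  imports Main "HOL-Library.Nat_Bijection"
begin

section \<open>Terms and term rewriting\<close>

text \<open>A ranked alphabet is a finite set of pairs (symbol, rank) in which every symbol has only
  one rank. With this representation, inclusion of ranked alphabets is plain set inclusion.\<close>

datatype ('f, 'v) "term" = Var 'v | Fun 'f "('f, 'v) term list"

definition ranked_alphabet :: "('f \<times> nat) set \<Rightarrow> bool" where
  "ranked_alphabet \<Sigma> \<longleftrightarrow> finite \<Sigma> \<and> single_valued \<Sigma>"

inductive_set terms :: "('f \<times> nat) set \<Rightarrow> ('f, 'v) term set" for \<Sigma> where
  "Var x \<in> terms \<Sigma>"
| "(f, length ts) \<in> \<Sigma> \<Longrightarrow> (\<And>t. t \<in> set ts \<Longrightarrow> t \<in> terms \<Sigma>) \<Longrightarrow> Fun f ts \<in> terms \<Sigma>"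

primrec vars_list :: "('f, 'v) term \<Rightarrow> 'v list" where
  "vars_list (Var x) = [x]"
| "vars_list (Fun f ts) = concat (map vars_list ts)"

definition ground_terms :: "('f \<times> nat) set \<Rightarrow> ('f, 'v) term set" where
  "ground_terms \<Sigma> = {t \<in> terms \<Sigma>. vars_list t = []}"

primrec symbols :: "('f, 'v) term \<Rightarrow> ('f \<times> nat) set" where
  "symbols (Var x) = {}"
| "symbols (Fun f ts) = insert (f, length ts) (\<Union> (set (map symbols ts)))"

primrec height :: "('f, 'v) term \<Rightarrow> nat" where
  "height (Var x) = 0"
| "height (Fun f ts) = (if ts = [] then 0 else Suc (Max (set (map height ts))))"

primrec subst :: "('v \<Rightarrow> ('f, 'w) term) \<Rightarrow> ('f, 'v) term \<Rightarrow> ('f, 'w) term" where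
  "subst \<sigma> (Var x) = \<sigma> x"
| "subst \<sigma> (Fun f ts) = Fun f (map (subst \<sigma>) ts)"

type_synonym ('f, 'v) rules = "(('f, 'v) term \<times> ('f, 'v) term) set"

definition trs :: "('f \<times> nat) set \<Rightarrow> ('f, 'v) rules \<Rightarrow> bool" where
  "trs \<Sigma> R \<longleftrightarrow> finite R \<and>
     (\<forall>(l, r) \<in> R. l \<in> terms \<Sigma> \<and> r \<in> terms \<Sigma> \<and> set (vars_list r) \<subseteq> set (vars_list l))"

definition sign :: "('f, 'v) rules \<Rightarrow> ('f \<times> nat) set" where
  "sign R = (\<Union>(l, r) \<in> R. symbols l \<union> symbols r)"

definition left_linear :: "('f, 'v) rules \<Rightarrow> bool" where
  "left_linear R \<longleftrightarrow> (\<forall>(l, r) \<in> R. distinct (vars_list l))"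

definition monadic :: "('f, 'v) rules \<Rightarrow> bool" where
  "monadic R \<longleftrightarrow> (\<forall>(l, r) \<in> R. 1 \<le> height l \<and> height r \<le> 1)"

inductive_set rstep :: "('f, 'v) rules \<Rightarrow> ('f, 'v) rules" for R where
  root: "(l, r) \<in> R \<Longrightarrow> (subst \<sigma> l, subst \<sigma> r) \<in> rstep R"
| arg: "(s, t) \<in> rstep R \<Longrightarrow> (Fun f (us @ s # vs), Fun f (us @ t # vs)) \<in> rstep R"

definition rstep_over :: "('f \<times> nat) set \<Rightarrow> ('f, 'v) rules \<Rightarrow> ('f, 'v) rules" where
  "rstep_over \<Sigma> R = rstep R \<inter> (terms \<Sigma> \<times> terms \<Sigma>)"

definition descendants ::
  "('f \<times> nat) set \<Rightarrow> ('f, 'v) rules \<Rightarrow> ('f, 'v) term set \<Rightarrow> ('f, 'v) term set" where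
  "descendants \<Sigma> R L = {p. \<exists>q \<in> L. (q, p) \<in> (rstep_over \<Sigma> R)\<^sup>*}"


section \<open>Bottom-up tree automata\<close>

text \<open>An element \<open>(f, [a1, \<dots>, an], a)\<close> of \<open>trans\<close> is the rule \<open>f(a1, \<dots>, an) \<rightarrow> a\<close>, an element
  \<open>(a, b)\<close> of \<open>eps\<close> is the rule \<open>a \<rightarrow> b\<close>.\<close>

record ('f, 'q) bta =
  states :: "'q set"
  finals :: "'q set"
  trans :: "('f \<times> 'q list \<times> 'q) set"
  eps :: "('q \<times> 'q) set"

definition bta_over :: "('f \<times> nat) set \<Rightarrow> ('f, 'q) bta \<Rightarrow> bool" where
  "bta_over \<Sigma> C \<longleftrightarrow> finite (states C) \<and> finals C \<subseteq> states C \<and>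
     finite (trans C) \<and>
     (\<forall>(f, qs, q) \<in> trans C. (f, length qs) \<in> \<Sigma> \<and> set qs \<subseteq> states C \<and> q \<in> states C) \<and>
     eps C \<subseteq> states C \<times> states C"

text \<open>The automaton is a ground rewrite system over the disjoint union of the alphabet and the
  set of states, the latter with rank 0.\<close>

definition state_term :: "'q \<Rightarrow> ('f + 'q, 'v) term" where
  "state_term q = Fun (Inr q) []"

definition bta_alphabet :: "('f \<times> nat) set \<Rightarrow> ('f, 'q) bta \<Rightarrow> (('f + 'q) \<times> nat) set" where
  "bta_alphabet \<Sigma> C = (\<lambda>(f, n). (Inl f, n)) ` \<Sigma> \<union> (\<lambda>q. (Inr q, 0)) ` states C"

definition bta_rules :: "('f, 'q) bta \<Rightarrow> ('f + 'q, 'v) rules" where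
  "bta_rules C =
     (\<lambda>(f, qs, q). (Fun (Inl f) (map state_term qs), state_term q)) ` trans C \<union>
     (\<lambda>(a, b). (state_term a, state_term b)) ` eps C"

definition language :: "('f \<times> nat) set \<Rightarrow> ('f, 'q) bta \<Rightarrow> ('f, 'v) term set" where
  "language \<Sigma> C = {t \<in> ground_terms \<Sigma>. \<exists>q \<in> finals C.
     (map_term Inl id t, state_term q) \<in> (rstep_over (bta_alphabet \<Sigma> C) (bta_rules C))\<^sup>*}"

definition recognizable :: "('f \<times> nat) set \<Rightarrow> ('f, 'v) term set \<Rightarrow> bool" where
  "recognizable \<Sigma> L \<longleftrightarrow> (\<exists>C :: ('f, nat) bta. bta_over \<Sigma> C \<and> language \<Sigma> C = L)"

definition PSR_trs :: "('f \<times> nat) set \<Rightarrow> ('f, 'v) rules \<Rightarrow> bool" where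
  "PSR_trs \<Sigma> R \<longleftrightarrow>
     (\<forall>L \<subseteq> ground_terms \<Sigma>. recognizable \<Sigma> L \<longrightarrow> recognizable \<Sigma> (descendants \<Sigma> R L))"


section \<open>Partial recursive functions\<close>

text \<open>\<open>rec_computes F xs y\<close> means that the partial function denoted by \<open>F\<close> is defined at \<open>xs\<close>
  with value \<open>y\<close>. Ill-formed applications are undefined, so no separate arity check is needed.\<close>

datatype recf = Zero | Succ | Proj nat | Comp recf "recf list" | PrimRec recf recf | Mu recf

inductive rec_computes :: "recf \<Rightarrow> nat list \<Rightarrow> nat \<Rightarrow> bool" where
  Zero: "rec_computes Zero xs 0"
| Succ: "rec_computes Succ [x] (Suc x)"
| Proj: "i < length xs \<Longrightarrow> rec_computes (Proj i) xs (xs ! i)"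
| Comp: "list_all2 (\<lambda>g y. rec_computes g xs y) gs ys \<Longrightarrow> rec_computes f ys z \<Longrightarrow>
    rec_computes (Comp f gs) xs z"
| PrimRec_0: "rec_computes f xs y \<Longrightarrow> rec_computes (PrimRec f g) (0 # xs) y"
| PrimRec_Suc: "rec_computes (PrimRec f g) (n # xs) y \<Longrightarrow> rec_computes g (n # y # xs) z \<Longrightarrow>
    rec_computes (PrimRec f g) (Suc n # xs) z"
| Mu: "rec_computes f (n # xs) 0 \<Longrightarrow> (\<And>m. m < n \<Longrightarrow> \<exists>k > 0. rec_computes f (m # xs) k) \<Longrightarrow>
    rec_computes (Mu f) xs n"

inductive_cases rec_computes_ZeroE: "rec_computes Zero xs y"
inductive_cases rec_computes_SuccE: "rec_computes Succ xs y"
inductive_cases rec_computes_ProjE: "rec_computes (Proj i) xs y"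
inductive_cases rec_computes_CompE: "rec_computes (Comp f gs) xs y"
inductive_cases rec_computes_PrimRec_0E: "rec_computes (PrimRec f g) (0 # xs) y"
inductive_cases rec_computes_PrimRec_SucE: "rec_computes (PrimRec f g) (Suc n # xs) y"
inductive_cases rec_computes_MuE: "rec_computes (Mu f) xs y"

lemma rec_computes_unique:
  assumes "rec_computes F xs y" and "rec_computes F xs z"
  shows "y = z"
  using assms
proof (induction arbitrary: z rule: rec_computes.induct)
  case (Zero xs)
  then show ?case by (rule rec_computes_ZeroE) simp
next
  case (Succ x)
  then show ?case by (rule rec_computes_SuccE) simp
next
  case (Proj i xs)
  from Proj.prems show ?case by (rule rec_computes_ProjE) simp
next
  case (Comp xs gs ys f w)
  from Comp.prems obtain ys' where
    ys': "list_all2 (\<lambda>g y. rec_computes g xs y) gs ys'" "rec_computes f ys' z"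
    by (rule rec_computes_CompE)
  have "ys = ys'"
    using Comp.IH(1) ys'(1) by (auto simp: list_all2_conv_all_nth intro!: nth_equalityI)
  with Comp.IH(2) ys'(2) show ?case by blast
next
  case (PrimRec_0 f xs y g)
  from PrimRec_0.prems show ?case
    by (rule rec_computes_PrimRec_0E) (rule PrimRec_0.IH)
next
  case (PrimRec_Suc f g n xs y w)
  from PrimRec_Suc.prems obtain y' where
    "rec_computes (PrimRec f g) (n # xs) y'" "rec_computes g (n # y' # xs) z"
    by (rule rec_computes_PrimRec_SucE)
  with PrimRec_Suc.IH show ?case by blast
next
  case (Mu f n xs)
  from Mu.prems have z: "rec_computes f (z # xs) 0"
    "\<And>m. m < z \<Longrightarrow> \<exists>k > 0. rec_computes f (m # xs) k"
    by (auto elim!: rec_computes_MuE)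
  have "\<not> z < n"
  proof
    assume "z < n"
    with Mu.IH(2) obtain k where "0 < k" "\<And>y. rec_computes f (z # xs) y \<Longrightarrow> k = y" by blast
    with z(1) show False by blast
  qed
  moreover have "\<not> n < z"
  proof
    assume "n < z"
    with z(2) obtain k where "0 < k" "rec_computes f (n # xs) k" by blast
    with Mu.IH(1) show False by blast
  qed
  ultimately show ?case by simp
qed


section \<open>Effectivity\<close>

text \<open>Symbols, variables and states are natural numbers here, and inputs and outputs of
  algorithms are the canonical codes of the finite objects concerned (\<open>set_encode\<close> is the
  binary code of a finite set of natural numbers).\<close>

primrec term_code :: "(nat, nat) term \<Rightarrow> nat" where
  "term_code (Var x) = sum_encode (Inl x)"
| "term_code (Fun f ts) = sum_encode (Inr (prod_encode (f, list_encode (map term_code ts))))"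

lemma term_code_inject: "term_code s = term_code t \<longleftrightarrow> s = t"
proof (induction s arbitrary: t)
  case (Var x)
  show ?case by (cases t) (auto simp: sum_encode_eq)
next
  case (Fun f ss)
  show ?case
  proof (cases t)
    case (Fun g ts)
    have "map term_code ss = map term_code ts \<longleftrightarrow> ss = ts"
      using Fun.IH by (auto simp: list_eq_iff_nth_eq)
    then show ?thesis using Fun by (simp add: sum_encode_eq prod_encode_eq list_encode_eq)
  qed (simp add: sum_encode_eq)
qed

definition alphabet_code :: "(nat \<times> nat) set \<Rightarrow> nat" where
  "alphabet_code \<Sigma> = set_encode (prod_encode ` \<Sigma>)"

definition language_code :: "(nat, nat) term set \<Rightarrow> nat" where
  "language_code L = set_encode (term_code ` L)"

definition trans_code :: "nat \<times> nat list \<times> nat \<Rightarrow> nat" where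
  "trans_code = (\<lambda>(f, qs, q). prod_encode (prod_encode (f, list_encode qs), q))"

definition bta_code :: "(nat, nat) bta \<Rightarrow> nat" where
  "bta_code C = prod_encode (set_encode (states C), prod_encode (set_encode (finals C),
     prod_encode (set_encode (trans_code ` trans C), set_encode (prod_encode ` eps C))))"

definition EPRF_trs :: "(nat, nat) rules \<Rightarrow> bool" where
  "EPRF_trs R \<longleftrightarrow> (\<exists>F. \<forall>\<Sigma> L.
     ranked_alphabet \<Sigma> \<and> sign R \<subseteq> \<Sigma> \<and> finite L \<and> L \<subseteq> ground_terms \<Sigma> \<longrightarrow>
     (\<exists>C. rec_computes F [alphabet_code \<Sigma>, language_code L] (bta_code C) \<and>
          bta_over \<Sigma> C \<and> language \<Sigma> C = descendants \<Sigma> R L))"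

end

theory Submission
  imports Defs
begin

text \<open>The system consists of the single rule \<open>f(x) \<rightarrow> g(x, x)\<close>. Applied to the recognizable set of the
  terms \<open>f(h\<^sup>n(a))\<close> it yields the terms \<open>g(h\<^sup>n(a), h\<^sup>n(a))\<close>, and by the pigeonhole principle no
  automaton can compare the two arguments. For a finite set \<open>L\<close>, take as states (the codes of)
  finitely many terms, among them all subterms of elements of \<open>L\<close>, with the transitions \<open>k(s\<^sub>1, \<dots>, s\<^sub>n) \<rightarrow> s\<close> for the
  term \<open>s = k(s\<^sub>1, \<dots>, s\<^sub>n)\<close> and \<open>g(s, s) \<rightarrow> s'\<close> for the term \<open>s' = f(s)\<close>. Then the state \<open>s\<close> is reached
  exactly from the descendants of \<open>s\<close>; the second kind of transition is adequate although the two
  copies may be rewritten independently, because the state stands for a single term. The code of this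
  automaton is a primitive recursive function of the codes of the alphabet and of \<open>L\<close>.\<close>

section \<open>Computable functions\<close>

text \<open>Only total functions are considered, and values at lists of a length other than
  \<open>k\<close> are unconstrained. Predicates are handled through their truth value
  \<open>of_bool\<close>.\<close>

definition computable :: "nat \<Rightarrow> (nat list \<Rightarrow> nat) \<Rightarrow> bool" where
  "computable k f \<longleftrightarrow> (\<exists>F. \<forall>xs. length xs = k \<longrightarrow> rec_computes F xs (f xs))"

lemma computable_cong:
  assumes "computable k f" and "\<And>xs. length xs = k \<Longrightarrow> f xs = g xs"
  shows "computable k g"
  using assms unfolding computable_def by metis

lemma computable_nth: "i < k \<Longrightarrow> computable k (\<lambda>xs. xs ! i)"
  unfolding computable_def by (metis rec_computes.Proj)

text \<open>A bounded operator over \<open>k\<close> arguments puts its bound variable in front, so that inside its body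
  the bound variable is \<open>ys ! 0\<close> and the outer arguments are \<open>tl ys\<close>.\<close>

lemma computable_nth_tl: "Suc i < k \<Longrightarrow> computable k (\<lambda>xs. tl xs ! i)"
  by (rule computable_cong[OF computable_nth]) (auto simp: nth_tl)

lemma computable_nth_tl_tl: "Suc (Suc i) < k \<Longrightarrow> computable k (\<lambda>xs. tl (tl xs) ! i)"
  by (rule computable_cong[OF computable_nth]) (auto simp: nth_tl)

lemma computable_compose:
  assumes "computable (length gs) f" and "\<And>g. g \<in> set gs \<Longrightarrow> computable k g"
  shows "computable k (\<lambda>xs. f (map (\<lambda>g. g xs) gs))"
proof -
  obtain F where F: "\<And>xs. length xs = length gs \<Longrightarrow> rec_computes F xs (f xs)"
    using assms(1) unfolding computable_def by blast
  obtain G where G: "\<And>g xs. g \<in> set gs \<Longrightarrow> length xs = k \<Longrightarrow> rec_computes (G g) xs (g xs)"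
    using assms(2) unfolding computable_def by metis
  have "rec_computes (Comp F (map G gs)) xs (f (map (\<lambda>g. g xs) gs))" if "length xs = k" for xs
    by (rule rec_computes.Comp[where ys = "map (\<lambda>g. g xs) gs"])
      (auto simp: list_all2_conv_all_nth F G that)
  then show ?thesis
    unfolding computable_def by blast
qed

lemma computable_Suc:
  assumes "computable k a"
  shows "computable k (\<lambda>xs. Suc (a xs))"
proof -
  have "computable 1 (\<lambda>xs. Suc (xs ! 0))"
    unfolding computable_def by (auto simp: length_Suc_conv intro!: exI[of _ Succ] rec_computes.Succ)
  then show ?thesis
    using computable_compose[of "[a]" "\<lambda>xs. Suc (xs ! 0)" k] assms by simp
qed

lemma computable_const: "computable k (\<lambda>xs. c)"
proof (induction c)
  case 0
  show ?case unfolding computable_def by (metis rec_computes.Zero)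
qed (rule computable_Suc)

text \<open>\<open>PrimRec\<close> recurses on its first argument and passes the others on as
  parameters. Composing it with \<open>b\<close> followed by all \<open>k\<close> projections lets
  the recursion run for \<open>b xs\<close> steps while every argument stays available.\<close>

lemma computable_rec_nat:
  assumes "computable k b" and a: "computable k a"
    and g: "computable (Suc (Suc k)) (\<lambda>ys. g (ys ! 0) (tl ys ! 0) (tl (tl ys)))"
  shows "computable k (\<lambda>xs. rec_nat (a xs) (\<lambda>n y. g n y xs) (b xs))"
proof -
  obtain A where A: "\<And>xs. length xs = k \<Longrightarrow> rec_computes A xs (a xs)"
    using a unfolding computable_def by blast
  obtain G where G: "\<And>n y xs. length xs = k \<Longrightarrow> rec_computes G (n # y # xs) (g n y xs)"
    using g unfolding computable_def by (metis length_Cons list.sel(3) nth_Cons_0)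
  have "rec_computes (PrimRec A G) (n # xs) (rec_nat (a xs) (\<lambda>n y. g n y xs) n)"
    if "length xs = k" for n xs
    using that by (induction n) (auto intro: rec_computes.intros A G)
  then have "computable (Suc k) (\<lambda>ys. rec_nat (a (tl ys)) (\<lambda>n y. g n y (tl ys)) (ys ! 0))"
    unfolding computable_def by (auto simp: length_Suc_conv intro!: exI[of _ "PrimRec A G"])
  moreover have "computable k h" if "h \<in> set (b # map (\<lambda>i xs. xs ! i) [0..<k])" for h
    using that assms(1) by (auto intro: computable_nth)
  ultimately have "computable k (\<lambda>xs. rec_nat (a (map (\<lambda>i. xs ! i) [0..<k]))
      (\<lambda>n y. g n y (map (\<lambda>i. xs ! i) [0..<k])) (b xs))"
    using computable_compose[of "b # map (\<lambda>i xs. xs ! i) [0..<k]"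
      "\<lambda>ys. rec_nat (a (tl ys)) (\<lambda>n y. g n y (tl ys)) (ys ! 0)" k]
    by (simp add: o_def)
  then show ?thesis
    by (rule computable_cong) (metis map_nth)
qed

lemma map_nth_drop: "length xs = n + k \<Longrightarrow> map (\<lambda>i. xs ! (n + i)) [0..<k] = drop n xs"
  by (rule nth_equalityI) auto

lemma computable_tl:
  assumes "computable k f"
  shows "computable (Suc k) (\<lambda>xs. f (tl xs))"
proof -
  have "computable (Suc k) h" if "h \<in> set (map (\<lambda>i xs. xs ! (1 + i)) [0..<k])" for h
    using that by (auto intro: computable_nth)
  then have "computable (Suc k) (\<lambda>xs. f (map (\<lambda>i. xs ! (1 + i)) [0..<k]))"
    using computable_compose[of "map (\<lambda>i xs. xs ! (1 + i)) [0..<k]" f "Suc k"] assms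
    by (simp add: o_def)
  then show ?thesis
    by (rule computable_cong) (subst map_nth_drop, auto simp: drop_Suc)
qed

section \<open>Sums, products, truncated differences and powers of two\<close>

lemma computable_add:
  assumes "computable k a" and "computable k b"
  shows "computable k (\<lambda>xs. a xs + b xs)"
proof -
  have "rec_nat x (\<lambda>n. Suc) n = x + n" for x n :: nat
    by (induction n) auto
  then show ?thesis
    using computable_rec_nat[OF assms(2,1), of "\<lambda>n y xs. Suc y"]
    by (simp add: computable_Suc computable_nth_tl)
qed

text \<open>Bounded sums serve as the general search device: bounded quantifiers, quotients, set
  codes and inverses of codings are all written as sums below.\<close>

lemma computable_sum:
  assumes "computable (Suc k) (\<lambda>ys. f (ys ! 0) (tl ys))" and "computable k b"
  shows "computable k (\<lambda>xs. \<Sum>i<b xs. f i xs)"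
proof -
  have *: "rec_nat 0 (\<lambda>n y. y + f n xs) n = (\<Sum>i<n. f i xs)" for xs n
    by (induction n) auto
  \<comment> \<open>The recursion step receives index, accumulator and parameters in this order. The
    summand must not see the accumulator at position 1, hence the projections start at position
    2.\<close>
  have "computable (Suc (Suc k)) h"
    if "h \<in> set ((\<lambda>ys. ys ! 0) # map (\<lambda>i ys. ys ! (2 + i)) [0..<k])" for h
    using that by (auto intro: computable_nth)
  then have "computable (Suc (Suc k)) (\<lambda>ys. f (ys ! 0) (map (\<lambda>i. ys ! (2 + i)) [0..<k]))"
    using computable_compose[of "(\<lambda>ys. ys ! 0) # map (\<lambda>i ys. ys ! (2 + i)) [0..<k]"
      "\<lambda>ys. f (ys ! 0) (tl ys)" "Suc (Suc k)"] assms(1)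
    by (simp add: o_def)
  then have "computable (Suc (Suc k)) (\<lambda>ys. f (ys ! 0) (tl (tl ys)))"
    by (rule computable_cong) (subst map_nth_drop, auto simp: drop_Suc numeral_2_eq_2)
  then show ?thesis
    using computable_rec_nat[OF assms(2) computable_const[of k 0], of "\<lambda>n y xs. y + f n xs"]
    by (simp add: * computable_add computable_nth_tl)
qed

lemma computable_mult:
  assumes "computable k a" and "computable k b"
  shows "computable k (\<lambda>xs. a xs * b xs)"
  using computable_sum[OF computable_tl[OF assms(2)] assms(1)] by simp

text \<open>The predecessor is the recursion that discards its accumulator and returns the index;
  iterating it gives truncated subtraction.\<close>

lemma computable_diff:
  assumes "computable k a" and "computable k b"
  shows "computable k (\<lambda>xs. a xs - b xs)"
proof -
  have pred: "rec_nat 0 (\<lambda>n y. n) n = n - 1" for n :: nat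
    by (cases n) auto
  have diff: "rec_nat x (\<lambda>n y. y - 1) n = x - n" for x n :: nat
    by (induction n) auto
  have "computable k (\<lambda>xs. a xs - 1)" if "computable k a" for k a
    using computable_rec_nat[OF that computable_const[of k 0], of "\<lambda>n y xs. n"]
    by (simp add: pred computable_nth)
  then show ?thesis
    using computable_rec_nat[OF assms(2,1), of "\<lambda>n y xs. y - 1"]
    by (simp only: diff) (simp add: computable_nth_tl)
qed

lemma computable_power2:
  assumes "computable k a"
  shows "computable k (\<lambda>xs. 2 ^ a xs)"
proof -
  have "rec_nat 1 (\<lambda>n y. y + y) n = (2 :: nat) ^ n" for n
    by (induction n) auto
  then show ?thesis
    using computable_rec_nat[OF assms computable_const[of k 1], of "\<lambda>n y xs. y + y"]
    by (simp add: computable_nth_tl computable_add)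
qed

section \<open>Decidable predicates, bounded search and division\<close>

lemma computable_not:
  assumes "computable k (\<lambda>xs. of_bool (P xs))"
  shows "computable k (\<lambda>xs. of_bool (\<not> P xs))"
  by (rule computable_cong[OF computable_diff[OF computable_const[of k 1] assms]]) auto

lemma computable_conj:
  assumes "computable k (\<lambda>xs. of_bool (P xs))" and "computable k (\<lambda>xs. of_bool (Q xs))"
  shows "computable k (\<lambda>xs. of_bool (P xs \<and> Q xs))"
  by (rule computable_cong[OF computable_mult[OF assms]]) auto

lemma computable_disj:
  assumes "computable k (\<lambda>xs. of_bool (P xs))" and "computable k (\<lambda>xs. of_bool (Q xs))"
  shows "computable k (\<lambda>xs. of_bool (P xs \<or> Q xs))"
  using computable_not[OF computable_conj[OF computable_not computable_not], OF assms]
  by simp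

text \<open>With truncated subtraction, \<open>1 - (a - b)\<close> is the truth value of
  \<open>a \<le> b\<close>.\<close>

lemma computable_le:
  assumes "computable k a" and "computable k b"
  shows "computable k (\<lambda>xs. of_bool (a xs \<le> b xs))"
  by (rule computable_cong[OF computable_diff[OF computable_const[of k 1]
    computable_diff[OF assms]]]) auto

lemma computable_eq:
  assumes "computable k a" and "computable k b"
  shows "computable k (\<lambda>xs. of_bool (a xs = b xs))"
  using computable_conj[OF computable_le computable_le, OF assms assms(2,1)]
  by (simp add: antisym_conv1 eq_iff)

text \<open>The sum of the truth values counts the witnesses, and it suffices to compare this number
  with 1.\<close>

lemma computable_bex:
  assumes "computable (Suc k) (\<lambda>ys. of_bool (P (ys ! 0) (tl ys)))" and "computable k b"
  shows "computable k (\<lambda>xs. of_bool (\<exists>i<b xs. P i xs))"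
proof -
  have "computable k (\<lambda>xs. of_bool (1 \<le> (\<Sum>i<b xs. of_bool (P i xs) :: nat)))"
    by (intro computable_le computable_const computable_sum assms)
  then show ?thesis
    by (rule computable_cong) (auto simp: Suc_le_eq simp del: sum_of_bool_eq)
qed

text \<open>The quotient counts the positive multiples of the divisor that do not exceed the
  dividend. For divisor 0 this count would be the dividend and not 0, hence the positivity
  assumption.\<close>

lemma computable_div:
  assumes "computable k a" and "computable k b" and pos: "\<And>xs. length xs = k \<Longrightarrow> 0 < b xs"
  shows "computable k (\<lambda>xs. a xs div b xs)"
proof -
  have *: "(\<Sum>i<n. of_bool (Suc i * m \<le> n)) = n div m" if "0 < m" for n m :: nat
  proof -
    have "{i \<in> {..<n}. Suc i * m \<le> n} = {..<n div m}"
      using that by (auto simp: less_eq_div_iff_mult_less_eq[symmetric] Suc_le_eq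
        intro: less_le_trans[OF _ div_le_dividend] simp del: mult_Suc)
    then show ?thesis by (simp add: Int_def del: mult_Suc)
  qed
  have "computable k (\<lambda>xs. \<Sum>i<a xs. of_bool (Suc i * b xs \<le> a xs))"
    by (intro computable_sum computable_le computable_mult computable_Suc computable_nth
      computable_tl assms) simp
  then show ?thesis
    by (rule computable_cong) (simp only: * pos)
qed

lemma computable_odd:
  assumes "computable k a"
  shows "computable k (\<lambda>xs. of_bool (odd (a xs)))"
proof -
  have "computable k (\<lambda>xs. of_bool (a xs = 2 * (a xs div 2) + 1))"
    by (intro computable_eq computable_add computable_mult computable_div computable_const assms)
      simp
  then show ?thesis
    by (rule computable_cong) (intro arg_cong[where f = of_bool], presburger)
qed

section \<open>Codes of pairs, finite sets and lists\<close>

lemma computable_prod_encode: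
  assumes "computable k a" and "computable k b"
  shows "computable k (\<lambda>xs. prod_encode (a xs, b xs))"
  unfolding prod_encode_def prod.case triangle_def
  by (intro computable_add computable_mult computable_div computable_Suc computable_const assms) simp

lemma computable_mem_set_decode:
  assumes "computable k a" and "computable k b"
  shows "computable k (\<lambda>xs. of_bool (a xs \<in> set_decode (b xs)))"
  unfolding set_decode_def mem_Collect_eq
  by (intro computable_odd computable_div computable_power2 assms) simp

lemma computable_set_encode:
  assumes "computable (Suc k) (\<lambda>ys. of_bool (P (ys ! 0) (tl ys)))" and "computable k b"
  shows "computable k (\<lambda>xs. set_encode {i. i < b xs \<and> P i xs})"
proof -
  have "(\<Sum>i<n. of_bool (P i xs) * 2 ^ i) = set_encode {i. i < n \<and> P i xs}" for n xs
    unfolding set_encode_def by (rule sum.mono_neutral_cong_right) auto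
  moreover have "computable k (\<lambda>xs. \<Sum>i<b xs. of_bool (P i xs) * 2 ^ i)"
    by (intro computable_sum computable_mult computable_power2 computable_nth assms) simp
  ultimately show ?thesis by simp
qed

lemma computable_set_encode_lessThan:
  assumes "computable k b"
  shows "computable k (\<lambda>xs. set_encode {..<b xs})"
  using computable_set_encode[of k "\<lambda>_ _. True" b] assms
  by (simp add: computable_const lessThan_def)

lemma list_encode_drop:
  "list_encode (drop n xs) = rec_nat (list_encode xs) (\<lambda>_ c. snd (prod_decode (c - 1))) n"
proof (induction n)
  case (Suc n)
  \<comment> \<open>This covers the empty list: its code 0 has truncated predecessor 0, which
    decodes to a pair with second component 0, so dropping beyond the end stays at the empty
    list.\<close>
  have "prod_decode 0 = (0, 0)"
    using prod_encode_inverse[of "(0, 0)"] by (simp add: prod_encode_def)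
  then have "list_encode (tl ys) = snd (prod_decode (list_encode ys - 1))" for ys
    by (cases ys) auto
  then show ?case
    using Suc.IH by (simp add: drop_Suc flip: tl_drop)
qed simp

lemma length_le_list_encode: "length xs \<le> list_encode xs"
  by (induction xs) (auto intro: le_trans[OF _ le_prod_encode_2])

text \<open>Both components of a pair are at most its code, so a search up to the code finds them.
  As the first component is unique, the sum over all candidates has it as its only possibly nonzero
  term.\<close>

lemma computable_fst_prod_decode:
  assumes "computable k a"
  shows "computable k (\<lambda>xs. fst (prod_decode (a xs)))"
proof -
  have *: "(\<Sum>i<Suc n. i * of_bool (\<exists>j<Suc n. prod_encode (i, j) = n)) = fst (prod_decode n)" for n
  proof -
    obtain i j where n: "n = prod_encode (i, j)"
      by (metis prod_decode_inverse surj_pair)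
    have "(\<Sum>i'<Suc n. i' * of_bool (\<exists>j'<Suc n. prod_encode (i', j') = n))
        = (\<Sum>i'<Suc n. if i' = i then i else 0)"
      using le_prod_encode_2[of j i] by (intro sum.cong) (auto simp: n less_Suc_eq_le prod_encode_eq)
    then show ?thesis
      using le_prod_encode_1[of i j] by (simp add: n less_Suc_eq_le)
  qed
  have "computable k (\<lambda>xs. \<Sum>i<Suc (a xs). i * of_bool (\<exists>j<Suc (a xs). prod_encode (i, j) = a xs))"
    by (intro computable_sum computable_mult computable_bex computable_eq computable_prod_encode
      computable_nth computable_nth_tl computable_tl computable_Suc assms) auto
  then show ?thesis
    by (simp only: *)
qed

lemma computable_snd_prod_decode:
  assumes "computable k a"
  shows "computable k (\<lambda>xs. snd (prod_decode (a xs)))"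
proof -
  have *: "(\<Sum>j<Suc n. j * of_bool (\<exists>i<Suc n. prod_encode (i, j) = n)) = snd (prod_decode n)" for n
  proof -
    obtain i j where n: "n = prod_encode (i, j)"
      by (metis prod_decode_inverse surj_pair)
    have "(\<Sum>j'<Suc n. j' * of_bool (\<exists>i'<Suc n. prod_encode (i', j') = n))
        = (\<Sum>j'<Suc n. if j' = j then j else 0)"
      using le_prod_encode_1[of i j] by (intro sum.cong) (auto simp: n less_Suc_eq_le prod_encode_eq)
    then show ?thesis
      using le_prod_encode_2[of j i] by (simp add: n less_Suc_eq_le)
  qed
  have "computable k (\<lambda>xs. \<Sum>j<Suc (a xs). j * of_bool (\<exists>i<Suc (a xs). prod_encode (i, j) = a xs))"
    by (intro computable_sum computable_mult computable_bex computable_eq computable_prod_encode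
      computable_nth computable_nth_tl computable_tl computable_Suc assms) auto
  then show ?thesis
    by (simp only: *)
qed

text \<open>The length is the number of \<open>i\<close> for which dropping \<open>i\<close>
  elements leaves a nonempty list, that is, a nonzero code. Indices below the code suffice since a
  list is no longer than its code.\<close>

lemma computable_length_list_decode:
  assumes "computable k a"
  shows "computable k (\<lambda>xs. length (list_decode (a xs)))"
proof -
  have *: "(\<Sum>i<n. of_bool (\<not> list_encode (drop i (list_decode n)) = 0)) = length (list_decode n)" for n
  proof -
    have "list_encode ys = 0 \<longleftrightarrow> ys = []" for ys
      by (cases ys) auto
    moreover have "{i \<in> {..<n}. i < length (list_decode n)} = {..<length (list_decode n)}"
      using length_le_list_encode[of "list_decode n"] by auto
    ultimately show ?thesis
      by (simp add: Int_def not_le)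
  qed
  have "computable k (\<lambda>xs. \<Sum>i<a xs. of_bool (\<not> list_encode (drop i (list_decode (a xs))) = 0))"
    unfolding list_encode_drop list_decode_inverse
    by (intro computable_sum computable_not computable_eq computable_rec_nat computable_diff
      computable_snd_prod_decode computable_nth computable_nth_tl computable_tl computable_const assms) auto
  then show ?thesis
    by (simp only: *)
qed


section \<open>Runs of tree automata\<close>

text \<open>Evaluation from the leaves to the root, which supports induction along the term, whereas
  \<open>language\<close> rewrites terms mixed with states in any order. The lemma
  \<open>language_eq_run\<close> connects the two.\<close>

inductive run :: "('f, 'q) bta \<Rightarrow> ('f, 'v) term \<Rightarrow> 'q \<Rightarrow> bool" for C where
  run_trans: "(f, qs, q) \<in> trans C \<Longrightarrow> list_all2 (run C) ts qs \<Longrightarrow> run C (Fun f ts) q"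
| run_eps: "run C t p \<Longrightarrow> (p, q) \<in> eps C \<Longrightarrow> run C t q"

text \<open>Runs on the terms in which states already occur as constants, as in the rewrite sequences that
  define \<open>language\<close>.\<close>

inductive mixed_run :: "('f, 'q) bta \<Rightarrow> ('f + 'q, 'v) term \<Rightarrow> 'q \<Rightarrow> bool" for C where
  mixed_run_state: "mixed_run C (state_term q) q"
| mixed_run_trans: "(f, qs, q) \<in> trans C \<Longrightarrow> list_all2 (mixed_run C) us qs \<Longrightarrow>
    mixed_run C (Fun (Inl f) us) q"
| mixed_run_eps: "mixed_run C u p \<Longrightarrow> (p, q) \<in> eps C \<Longrightarrow> mixed_run C u q"

text \<open>The part of a run above an argument depends only on the state \<open>p\<close> that the
  argument reaches, so any other term reaching \<open>p\<close> can take its place.\<close>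

lemma run_replace_arg:
  assumes "run C (Fun f (us @ t # vs)) q"
  shows "\<exists>p. run C t p \<and> (\<forall>s. run C s p \<longrightarrow> run C (Fun f (us @ s # vs)) q)"
  using assms
proof (induction "Fun f (us @ t # vs)" q rule: run.induct)
  case (run_trans qs q)
  then show ?case
    by (fastforce simp: list_all2_append1 list_all2_Cons1
      intro!: run.run_trans list_all2_appendI elim: list_all2_mono)
qed (blast intro: run.run_eps)

lemma mixed_run_replace_arg:
  assumes "mixed_run C (Fun f (us @ t # vs)) q" and "\<And>p. mixed_run C t p \<Longrightarrow> mixed_run C s p"
  shows "mixed_run C (Fun f (us @ s # vs)) q"
  using assms(1)
proof (induction "Fun f (us @ t # vs)" q rule: mixed_run.induct)
  case (mixed_run_trans g qs q)
  then show ?case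
    by (fastforce simp: list_all2_append1 list_all2_Cons1 assms(2)
      intro!: mixed_run.mixed_run_trans list_all2_appendI elim: list_all2_mono)
qed (auto simp: state_term_def intro: mixed_run.mixed_run_eps)

lemma mixed_run_replace_state:
  assumes "mixed_run C (state_term p) q" and "mixed_run C u p"
  shows "mixed_run C u q"
  using assms
  by (induction "state_term p :: ('a + 'b, 'c) term" q rule: mixed_run.induct)
    (auto simp: state_term_def intro: mixed_run.mixed_run_eps)

lemma subst_state_term [simp]: "subst \<sigma> (state_term q) = state_term q"
  by (simp add: state_term_def)

text \<open>The rules are ground, and each left-hand side has a run to the state on the right, so
  whatever used that state can continue from there. Applied backwards from the final state constant,
  this turns a rewrite sequence into a run.\<close>

lemma mixed_run_rstep:
  assumes "(u, v) \<in> rstep (bta_rules C)" and "mixed_run C v q"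
  shows "mixed_run C u q"
  using assms
proof (induction arbitrary: q rule: rstep.induct)
  case (root l r \<sigma>)
  from root(1) consider
    (trans) f qs p where "(f, qs, p) \<in> trans C" "l = Fun (Inl f) (map state_term qs)" "r = state_term p"
  | (eps) p' p where "(p', p) \<in> eps C" "l = state_term p'" "r = state_term p"
    unfolding bta_rules_def by auto
  then show ?case
  proof cases
    case trans
    have "list_all2 (mixed_run C) (map state_term qs) qs"
      by (auto simp: list_all2_conv_all_nth intro: mixed_run_state)
    then have "mixed_run C (subst \<sigma> l) p"
      using trans by (auto simp: o_def intro: mixed_run_trans)
    then show ?thesis
      using root(2) trans(3) by (auto intro: mixed_run_replace_state)
  next
    case eps
    then have "mixed_run C (subst \<sigma> l) p"
      by (auto intro: mixed_run_eps mixed_run_state)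
    then show ?thesis
      using root(2) eps(3) by (auto intro: mixed_run_replace_state)
  qed
qed (blast intro: mixed_run_replace_arg)

lemma run_if_mixed_run:
  fixes C :: "('f, 'q) bta" and t :: "('f, 'v) term"
  assumes "mixed_run C (map_term Inl id t) q"
  shows "run C t q"
  using assms
proof (induction "map_term Inl id t :: ('f + 'q, 'v) term" q arbitrary: t rule: mixed_run.induct)
  case (mixed_run_state q)
  then show ?case by (cases t) (auto simp: state_term_def)
next
  case (mixed_run_trans f qs q us)
  then show ?case
    by (cases t) (auto simp: list_all2_map1 elim!: list_all2_mono intro!: run.run_trans)
qed (blast intro: run_eps)

section \<open>Rewriting inside arguments, and rewrite sequences obtained from runs\<close>

lemma rtrancl_rstep_over_terms:
  assumes "(s, t) \<in> (rstep_over \<Sigma> R)\<^sup>*" and "s \<in> terms \<Sigma>"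
  shows "t \<in> terms \<Sigma>"
  using assms by (induction rule: rtrancl_induct) (auto simp: rstep_over_def)

lemma rtrancl_rstep_over_arg:
  assumes "(s, t) \<in> (rstep_over \<Sigma> R)\<^sup>*"
    and "(f, Suc (length us + length vs)) \<in> \<Sigma>" and "set us \<union> set vs \<subseteq> terms \<Sigma>"
  shows "(Fun f (us @ s # vs), Fun f (us @ t # vs)) \<in> (rstep_over \<Sigma> R)\<^sup>*"
  using assms(1)
proof (induction rule: rtrancl_induct)
  case (step t t')
  have "Fun f (us @ w # vs) \<in> terms \<Sigma>" if "w \<in> terms \<Sigma>" for w
    using assms(2,3) that by (intro terms.intros) auto
  with step(2) have "(Fun f (us @ t # vs), Fun f (us @ t' # vs)) \<in> rstep_over \<Sigma> R"
    by (auto simp: rstep_over_def intro: rstep.arg)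
  with step.IH show ?case by simp
qed simp

text \<open>Arguments are rewritten from left to right; \<open>us\<close> collects the finished ones
  and therefore varies in the induction.\<close>

lemma rtrancl_rstep_over_args:
  assumes "list_all2 (\<lambda>s t. (s, t) \<in> (rstep_over \<Sigma> R)\<^sup>*) ss ts"
    and "(f, length us + length ss) \<in> \<Sigma>" and "set us \<union> set ss \<subseteq> terms \<Sigma>"
  shows "(Fun f (us @ ss), Fun f (us @ ts)) \<in> (rstep_over \<Sigma> R)\<^sup>*"
  using assms
proof (induction ss ts arbitrary: us rule: list_all2_induct)
  case (Cons s ss t ts)
  have "(Fun f (us @ s # ss), Fun f (us @ t # ss)) \<in> (rstep_over \<Sigma> R)\<^sup>*"
    using Cons.hyps Cons.prems by (intro rtrancl_rstep_over_arg) auto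
  also have "(Fun f (us @ t # ss), Fun f (us @ t # ts)) \<in> (rstep_over \<Sigma> R)\<^sup>*"
    using Cons.IH[of "us @ [t]"] Cons.hyps Cons.prems rtrancl_rstep_over_terms[of s t] by auto
  finally show ?case .
qed simp

lemma Fun_mem_terms_iff: "Fun f ts \<in> terms \<Sigma> \<longleftrightarrow> (f, length ts) \<in> \<Sigma> \<and> set ts \<subseteq> terms \<Sigma>"
  by (auto intro: terms.intros elim: terms.cases)

lemma mem_bta_alphabet_iff [simp]:
  "(Inl f, n) \<in> bta_alphabet \<Sigma> C \<longleftrightarrow> (f, n) \<in> \<Sigma>"
  "(Inr q, n) \<in> bta_alphabet \<Sigma> C \<longleftrightarrow> q \<in> states C \<and> n = 0"
  unfolding bta_alphabet_def by force+

lemma map_term_mem_terms: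
  "t \<in> terms \<Sigma> \<Longrightarrow> map_term Inl id t \<in> terms (bta_alphabet \<Sigma> C)"
  by (induction rule: terms.induct)
    (auto simp: Fun_mem_terms_iff intro: terms.intros)

lemma rtrancl_rstep_over_if_run:
  assumes "run C t q" and C: "bta_over \<Sigma> C" and "t \<in> terms \<Sigma>"
  shows "(map_term Inl id t, state_term q) \<in> (rstep_over (bta_alphabet \<Sigma> C) (bta_rules C))\<^sup>*"
  using assms(1,3)
proof (induction rule: run.induct)
  case (run_trans f qs q ts)
  let ?S = "rstep_over (bta_alphabet \<Sigma> C) (bta_rules C)"
  have state: "state_term p \<in> terms (bta_alphabet \<Sigma> C)" if "p \<in> states C" for p
    using that by (simp add: state_term_def Fun_mem_terms_iff)
  have qs: "(f, length qs) \<in> \<Sigma>" "set qs \<subseteq> states C" "q \<in> states C"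
    using C run_trans(1) by (auto simp: bta_over_def)
  have f: "(Inl f, length qs) \<in> bta_alphabet \<Sigma> C"
    using qs(1) by simp
  have len: "length ts = length qs"
    using run_trans.IH by (rule list_all2_lengthD)
  have ts: "set ts \<subseteq> terms \<Sigma>"
    using run_trans.prems by (simp add: Fun_mem_terms_iff)
  have "list_all2 (\<lambda>u v. (u, v) \<in> ?S\<^sup>*) (map (map_term Inl id) ts) (map state_term qs)"
    using run_trans.IH by (simp add: list_all2_conv_all_nth subsetD[OF ts] id_def)
  from rtrancl_rstep_over_args[OF this, of "Inl f" "[]"]
  have "(map_term Inl id (Fun f ts), Fun (Inl f) (map state_term qs)) \<in> ?S\<^sup>*"
    using f len ts by (auto intro: map_term_mem_terms)
  also have "(Fun (Inl f) (map state_term qs), state_term q) \<in> ?S"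
  proof -
    have "(Fun (Inl f) (map state_term qs), state_term q) \<in> bta_rules C"
      using run_trans(1) by (force simp: bta_rules_def)
    \<comment> \<open>Automaton rules contain no variables, so any substitution serves.\<close>
    from rstep.root[OF this, of undefined] show ?thesis
      using f qs state by (auto simp: rstep_over_def o_def Fun_mem_terms_iff)
  qed
  finally show ?case .
next
  case (run_eps t p q)
  have "(state_term p, state_term q) \<in> bta_rules C"
    using run_eps.hyps by (force simp: bta_rules_def)
  moreover have "p \<in> states C" "q \<in> states C"
    using C run_eps.hyps by (auto simp: bta_over_def)
  ultimately have "(state_term p, state_term q) \<in> rstep_over (bta_alphabet \<Sigma> C) (bta_rules C)"
    using rstep.root[of "state_term p" "state_term q" "bta_rules C" undefined]
    by (auto simp: rstep_over_def state_term_def Fun_mem_terms_iff)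
  with run_eps show ?case by (auto intro: rtrancl_into_rtrancl)
qed

lemma run_if_rtrancl_rstep_over:
  fixes C :: "('f, 'q) bta" and t :: "('f, 'v) term"
  assumes "(map_term Inl id t, state_term q) \<in> (rstep_over (bta_alphabet \<Sigma> C) (bta_rules C))\<^sup>*"
  shows "run C t q"
proof -
  have "mixed_run C u q"
    if "(u, state_term q) \<in> (rstep_over (bta_alphabet \<Sigma> C) (bta_rules C))\<^sup>*" for u :: "('f + 'q, 'v) term"
    using that
    by (induction rule: converse_rtrancl_induct)
      (auto simp: rstep_over_def intro: mixed_run_state mixed_run_rstep)
  then show ?thesis
    using assms by (intro run_if_mixed_run)
qed

lemma language_eq_run:
  fixes C :: "('f, 'q) bta"
  assumes "bta_over \<Sigma> C"
  shows "language \<Sigma> C = {t :: ('f, 'v) term. t \<in> ground_terms \<Sigma> \<and> (\<exists>q \<in> finals C. run C t q)}"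
proof -
  have "(map_term Inl id t, state_term q) \<in> (rstep_over (bta_alphabet \<Sigma> C) (bta_rules C))\<^sup>* \<longleftrightarrow>
      run C t q" if "t \<in> ground_terms \<Sigma>" for t :: "('f, 'v) term" and q
    using that rtrancl_rstep_over_if_run[OF _ assms, of t q]
      run_if_rtrancl_rstep_over[of t q \<Sigma> C]
    by (auto simp: ground_terms_def)
  then show ?thesis
    unfolding language_def by auto
qed


section \<open>The duplicating rule\<close>

text \<open>The symbols \<open>f\<close>, \<open>g\<close>, \<open>h\<close>, \<open>a\<close> are \<open>0\<close>, \<open>1\<close>, \<open>2\<close>, \<open>3\<close>.\<close>

definition dup_rules :: "(nat, nat) rules" where
  "dup_rules = {(Fun 0 [Var 0], Fun 1 [Var 0, Var 0])}"

lemma rstep_dup_rules_cases: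
  assumes "(s, t) \<in> rstep dup_rules"
  obtains (root) u where "s = Fun 0 [u]" "t = Fun 1 [u, u]"
  | (arg) f us s' t' vs where "s = Fun f (us @ s' # vs)" "t = Fun f (us @ t' # vs)"
      "(s', t') \<in> rstep dup_rules"
  using assms by (cases rule: rstep.cases) (auto simp: dup_rules_def)

lemma rstep_dup_rules_root: "(Fun 0 [u], Fun 1 [u, u]) \<in> rstep dup_rules"
  using rstep.root[of "Fun 0 [Var 0]" "Fun 1 [Var 0, Var 0]" dup_rules "\<lambda>_. u"]
  by (simp add: dup_rules_def)

lemma vars_list_rstep_dup_rules:
  "(s, t) \<in> rstep dup_rules \<Longrightarrow> set (vars_list t) \<subseteq> set (vars_list s)"
  by (induction rule: rstep.induct) (auto simp: dup_rules_def)

lemma ground_terms_rtrancl_dup_rules: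
  assumes "(s, t) \<in> (rstep_over \<Sigma> dup_rules)\<^sup>*" and "s \<in> ground_terms \<Sigma>"
  shows "t \<in> ground_terms \<Sigma>"
  using assms
  by (induction rule: rtrancl_induct)
    (auto simp: ground_terms_def rstep_over_def dest: vars_list_rstep_dup_rules)

lemma Fun_mem_ground_terms_iff:
  "Fun f ts \<in> ground_terms \<Sigma> \<longleftrightarrow> (f, length ts) \<in> \<Sigma> \<and> set ts \<subseteq> ground_terms \<Sigma>"
  by (auto simp: ground_terms_def Fun_mem_terms_iff)


section \<open>Preservation of recognizability fails\<close>

abbreviation tower :: "nat \<Rightarrow> (nat, nat) term" where
  "tower n \<equiv> ((\<lambda>t. Fun 2 [t]) ^^ n) (Fun 3 [])"

definition tower_alphabet :: "(nat \<times> nat) set" where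
  "tower_alphabet = {(0, 1), (1, 2), (2, 1), (3, 0)}"

definition tower_bta :: "(nat, nat) bta" where
  "tower_bta = \<lparr>states = {0, 1}, finals = {1},
     trans = {(3, [], 0), (2, [0], 0), (0, [0], 1)}, eps = {}\<rparr>"

lemma run_tower_bta:
  "run tower_bta t q \<Longrightarrow> q = 0 \<and> t \<in> range tower \<or> q = 1 \<and> t \<in> (\<lambda>n. Fun 0 [tower n]) ` UNIV"
proof (induction rule: run.induct)
  case (run_trans f qs q ts)
  have "Fun 2 [tower n] \<in> range tower" for n
    by (rule range_eqI[of _ _ "Suc n"]) simp
  moreover have "Fun 3 [] \<in> range tower"
    by (rule range_eqI[of _ _ 0]) simp
  ultimately show ?case
    using run_trans by (auto simp: tower_bta_def list_all2_Cons2)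
qed (simp add: tower_bta_def)

lemma run_tower_bta_tower: "run tower_bta (tower n) 0"
  by (induction n) (auto simp: tower_bta_def intro!: run_trans)

lemma tower_mem_ground_terms: "tower n \<in> ground_terms tower_alphabet"
  by (induction n) (auto simp: Fun_mem_ground_terms_iff tower_alphabet_def)

lemma recognizable_towers:
  "recognizable tower_alphabet ((\<lambda>n. Fun 0 [tower n]) ` UNIV)"
proof -
  have C: "bta_over tower_alphabet tower_bta"
    by (auto simp: bta_over_def tower_alphabet_def tower_bta_def)
  have "Fun 0 [tower n] \<in> ground_terms tower_alphabet" for n
    using tower_mem_ground_terms by (auto simp: Fun_mem_ground_terms_iff tower_alphabet_def)
  moreover have "run tower_bta (Fun 0 [tower n]) 1" for n
    by (rule run_trans[of _ "[0]"]) (simp add: tower_bta_def, simp add: run_tower_bta_tower)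
  moreover have "finals tower_bta = {1}"
    by (simp add: tower_bta_def)
  ultimately have "language tower_alphabet tower_bta = (\<lambda>n. Fun 0 [tower n]) ` UNIV"
    unfolding language_eq_run[OF C] using run_tower_bta by fastforce
  with C show ?thesis
    unfolding recognizable_def by blast
qed

text \<open>Towers do not contain the symbol 0 and so are normal forms. Hence the only step from
  \<open>Fun 0 [tower n]\<close> is the one at the root, and its result is again normal.\<close>

lemma rstep_dup_rules_tower: "(tower n, t) \<notin> rstep dup_rules"
proof (induction n arbitrary: t)
  case 0
  show ?case by (auto elim: rstep_dup_rules_cases)
next
  case (Suc n)
  show ?case
  proof
    assume "(tower (Suc n), t) \<in> rstep dup_rules"
    then show False
      by (cases rule: rstep_dup_rules_cases) (auto simp: Cons_eq_append_conv Suc.IH)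
  qed
qed

lemma descendants_towers:
  assumes "t \<in> descendants \<Sigma> dup_rules ((\<lambda>n. Fun 0 [tower n]) ` UNIV)"
  shows "\<exists>n. t = Fun 0 [tower n] \<or> t = Fun 1 [tower n, tower n]"
proof -
  from assms obtain m where "(Fun 0 [tower m], t) \<in> (rstep_over \<Sigma> dup_rules)\<^sup>*"
    unfolding descendants_def by blast
  then show ?thesis
  proof (induction rule: rtrancl_induct)
    case (step t t')
    then have "(t, t') \<in> rstep dup_rules"
      by (simp add: rstep_over_def)
    then show ?case
      using step.IH
      by (cases rule: rstep_dup_rules_cases) (auto simp: append_eq_Cons_conv rstep_dup_rules_tower)
  qed blast
qed

lemma inj_tower: "inj tower"
proof (rule injI)
  show "m = n" if "tower m = tower n" for m n
    using that
  proof (induction m arbitrary: n)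
    case 0
    then show ?case by (cases n) auto
  next
    case (Suc m)
    then show ?case by (cases n) auto
  qed
qed

lemma not_PSR_trs_dup_rules: "\<not> PSR_trs tower_alphabet dup_rules"
proof
  let ?L = "(\<lambda>n. Fun 0 [tower n]) ` UNIV"
  assume PSR: "PSR_trs tower_alphabet dup_rules"
  have "?L \<subseteq> ground_terms tower_alphabet"
    using tower_mem_ground_terms by (auto simp: Fun_mem_ground_terms_iff tower_alphabet_def)
  with PSR recognizable_towers
  have "recognizable tower_alphabet (descendants tower_alphabet dup_rules ?L)"
    unfolding PSR_trs_def by simp
  then obtain C :: "(nat, nat) bta" where C: "bta_over tower_alphabet C"
    and L: "language tower_alphabet C = descendants tower_alphabet dup_rules ?L"
    unfolding recognizable_def by (elim exE conjE)
  have ground: "Fun 1 [tower m, tower n] \<in> ground_terms tower_alphabet" for m n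
    using tower_mem_ground_terms by (auto simp: Fun_mem_ground_terms_iff tower_alphabet_def)
  have "Fun 1 [tower n, tower n] \<in> descendants tower_alphabet dup_rules ?L" for n
  proof -
    have "(Fun 0 [tower n], Fun 1 [tower n, tower n]) \<in> rstep_over tower_alphabet dup_rules"
      using tower_mem_ground_terms[of n] unfolding rstep_over_def
      by (auto simp: rstep_dup_rules_root[simplified] Fun_mem_terms_iff tower_alphabet_def ground_terms_def)
    then show ?thesis
      unfolding descendants_def by blast
  qed
  then have "\<exists>q \<in> finals C. run C (Fun 1 [tower n, tower n]) q" for n
    using L unfolding language_eq_run[OF C] by blast
  \<comment> \<open>The accepting run is cut at the first argument: \<open>p\<close> is the state
    reached there, and the second copy is left untouched.\<close>
  then have "\<exists>q \<in> finals C. \<exists>p. run C (tower n) p \<and>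
      (\<forall>s. run C s p \<longrightarrow> run C (Fun 1 [s, tower n]) q)" for n
    using run_replace_arg[of C 1 "[]" "tower n" "[tower n]"] by fastforce
  then obtain p where p: "\<And>n. run C (tower n) (p n)"
    and replace: "\<And>n s. run C s (p n) \<Longrightarrow> \<exists>q \<in> finals C. run C (Fun 1 [s, tower n]) q"
    by metis
  have "q \<in> states C" if "run C t q" for t :: "(nat, nat) term" and q
    using that C by (induction rule: run.induct) (auto simp: bta_over_def)
  with p have "range p \<subseteq> states C"
    by blast
  then have "\<not> inj p"
    using C finite_subset finite_imageD infinite_UNIV_nat unfolding bta_over_def by blast
  then obtain m n where "p m = p n" "m \<noteq> n"
    unfolding inj_def by blast
  \<comment> \<open>Since \<open>tower m\<close> also reaches the state \<open>p n\<close>, it may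
    replace the first copy of \<open>tower n\<close>, which yields an accepted term with two
    different arguments.\<close>
  then have "Fun 1 [tower m, tower n] \<in> language tower_alphabet C"
    unfolding language_eq_run[OF C] using ground replace[of "tower m" n] p[of m] by auto
  then obtain k where "tower m = tower k" "tower n = tower k"
    using descendants_towers unfolding L by fastforce
  then have "m = n"
    using inj_eq[OF inj_tower] by simp
  with \<open>m \<noteq> n\<close> show False ..
qed


section \<open>Automata for the descendants of finite sets\<close>

text \<open>The number \<open>Suc (2 * prod_encode (f, list_encode qs))\<close> is the code of the
  term with root \<open>f\<close> and arguments coded by \<open>qs\<close>. States are numbers
  throughout, so transitions are arithmetic conditions on codes.\<close>

definition dup_trans :: "(nat \<times> nat) set \<Rightarrow> nat \<Rightarrow> (nat \<times> nat list \<times> nat) set" where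
  "dup_trans \<Sigma> B = {(f, qs, q). q < B \<and>
     (q = Suc (2 * prod_encode (f, list_encode qs)) \<and> (f, length qs) \<in> \<Sigma> \<or>
      (\<exists>p<B. f = 1 \<and> qs = [p, p] \<and> q = Suc (2 * prod_encode (0, list_encode [p]))))}"

definition dup_bta :: "(nat \<times> nat) set \<Rightarrow> nat \<Rightarrow> nat set \<Rightarrow> (nat, nat) bta" where
  "dup_bta \<Sigma> B Q = \<lparr>states = {..<B}, finals = Q, trans = dup_trans \<Sigma> B, eps = {}\<rparr>"

lemma dup_bta_simps [simp]:
  "states (dup_bta \<Sigma> B Q) = {..<B}" "finals (dup_bta \<Sigma> B Q) = Q"
  "trans (dup_bta \<Sigma> B Q) = dup_trans \<Sigma> B" "eps (dup_bta \<Sigma> B Q) = {}"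
  by (simp_all add: dup_bta_def)

lemma term_code_Fun: "term_code (Fun f ts) = Suc (2 * prod_encode (f, list_encode (map term_code ts)))"
  by (simp add: sum_encode_def)

declare term_code.simps(2) [simp del]

lemma less_list_encode: "x \<in> set xs \<Longrightarrow> x < list_encode xs"
proof (induction xs)
  case (Cons y xs)
  then show ?case
    using le_prod_encode_1[of y "list_encode xs"] le_prod_encode_2[of "list_encode xs" y] by auto
qed simp

text \<open>Arguments have smaller codes than the whole term, so the states below \<open>B\<close>
  are closed under passing to subterms.\<close>

lemma less_node_code: "x \<in> set xs \<Longrightarrow> x < Suc (2 * prod_encode (f, list_encode xs))"
  using less_list_encode[of x xs] le_prod_encode_2[of "list_encode xs" f] by linarith

lemma run_dup_bta_term_code:
  assumes "t \<in> ground_terms \<Sigma>" and "term_code t < B"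
  shows "run (dup_bta \<Sigma> B Q) t (term_code t)"
  using assms
proof (induction t)
  case (Fun f ts)
  have "list_all2 (run (dup_bta \<Sigma> B Q)) ts (map term_code ts)"
  proof (clarsimp simp: list_all2_conv_all_nth)
    fix i
    assume "i < length ts"
    then have i: "ts ! i \<in> set ts"
      by simp
    then have "term_code (ts ! i) < term_code (Fun f ts)"
      unfolding term_code_Fun by (intro less_node_code) simp
    then show "run (dup_bta \<Sigma> B Q) (ts ! i) (term_code (ts ! i))"
      using i Fun.prems by (intro Fun.IH) (auto simp: Fun_mem_ground_terms_iff)
  qed
  moreover have "(f, map term_code ts, term_code (Fun f ts)) \<in> trans (dup_bta \<Sigma> B Q)"
    using Fun.prems by (simp add: Fun_mem_ground_terms_iff dup_trans_def term_code_Fun)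
  ultimately show ?case
    by (intro run_trans)
qed (simp add: ground_terms_def)

lemma run_dup_bta_rstep:
  assumes "(t, t') \<in> rstep dup_rules" and "run (dup_bta \<Sigma> B Q) t q"
  shows "run (dup_bta \<Sigma> B Q) t' q"
  using assms
proof (induction arbitrary: q rule: rstep.induct)
  case (root l r \<sigma>)
  define u where "u = \<sigma> 0"
  have lr: "subst \<sigma> l = Fun 0 [u]" "subst \<sigma> r = Fun 1 [u, u]"
    using root(1) by (auto simp: dup_rules_def u_def)
  from root(2)[unfolded lr(1)] obtain p where p: "run (dup_bta \<Sigma> B Q) u p"
    "(0, [p], q) \<in> dup_trans \<Sigma> B"
    by (cases rule: run.cases) (auto simp: list_all2_Cons1)
  \<comment> \<open>A transition reading symbol 0 is of the first kind, so \<open>q\<close> is the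
    code of symbol 0 applied to \<open>p\<close>. This is the target that the second kind demands,
    and \<open>p < q < B\<close>.\<close>
  then have "(1, [p, p], q) \<in> dup_trans \<Sigma> B"
    using less_node_code[of p "[p]" 0] by (auto simp: dup_trans_def)
  then have "run (dup_bta \<Sigma> B Q) (Fun 1 [u, u]) q"
    using p(1) by (intro run_trans[of _ "[p, p]"]) auto
  then show ?case by (simp only: lr)
next
  case (arg s t f us vs)
  from run_replace_arg[OF arg.prems] arg.IH show ?case
    by blast
qed

text \<open>Induction on the run of \<open>t\<close> unfolds \<open>s\<close> in parallel. Since a
  code determines its term, the two arguments read by a duplicating transition are descendants of
  one and the same term.\<close>

lemma rtrancl_dup_rules_if_run_dup_bta:
  assumes "run (dup_bta \<Sigma> B Q) t (term_code s)" and "s \<in> terms \<Sigma>" and \<Sigma>: "(1, 2) \<in> \<Sigma>"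
  shows "(s, t) \<in> (rstep_over \<Sigma> dup_rules)\<^sup>*"
  using assms(1,2)
proof (induction t "term_code s" arbitrary: s rule: run.induct)
  case (run_trans f qs ts)
  \<comment> \<open>Variables have even codes and applications odd ones, so \<open>s\<close> is an
    application; its root and argument codes are recovered by injectivity.\<close>
  have node: "\<exists>ss. s = Fun g ss \<and> map term_code ss = xs"
    if "term_code s = Suc (2 * prod_encode (g, list_encode xs))" for g xs
    using that
    by (cases s) (auto simp: term_code_Fun list_encode_eq sum_encode_def, presburger)
  from run_trans(1) consider
    "term_code s = Suc (2 * prod_encode (f, list_encode qs))"
  | p where "f = 1" "qs = [p, p]" "term_code s = Suc (2 * prod_encode (0, list_encode [p]))"
    by (auto simp: dup_trans_def)
  then show ?case
  proof cases
    case 1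
    then obtain ss where s: "s = Fun f ss" "map term_code ss = qs"
      using node by blast
    have ss: "ss ! i \<in> terms \<Sigma>" if "i < length ss" for i
      using run_trans(3) s(1) that by (auto simp: Fun_mem_terms_iff subset_iff)
    have "list_all2 (\<lambda>s t. (s, t) \<in> (rstep_over \<Sigma> dup_rules)\<^sup>*) ss ts"
      using run_trans(2) by (auto simp: list_all2_conv_all_nth term_code_inject ss simp flip: s(2))
    from rtrancl_rstep_over_args[OF this, of f "[]"] show ?thesis
      using run_trans(3) s by (simp add: Fun_mem_terms_iff)
  next
    case 2
    then obtain s' where s: "s = Fun 0 [s']" "p = term_code s'"
      using node by blast
    then have s': "s' \<in> terms \<Sigma>"
      using run_trans(3) by (simp add: Fun_mem_terms_iff)
    \<comment> \<open>Duplication is done first; afterwards the two copies of \<open>s'\<close> are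
      rewritten independently to the two arguments of the target.\<close>
    have "(s, Fun 1 [s', s']) \<in> rstep_over \<Sigma> dup_rules"
      using run_trans(3) s' \<Sigma> s
      by (auto simp: rstep_over_def rstep_dup_rules_root[simplified] Fun_mem_terms_iff numeral_2_eq_2)
    moreover have "list_all2 (\<lambda>s t. (s, t) \<in> (rstep_over \<Sigma> dup_rules)\<^sup>*) [s', s'] ts"
      using run_trans(2) s s' 2(2) by (auto simp: list_all2_Cons2)
    from rtrancl_rstep_over_args[OF this, of 1 "[]"]
    have "(Fun 1 [s', s'], Fun 1 ts) \<in> (rstep_over \<Sigma> dup_rules)\<^sup>*"
      using \<Sigma> s' by (simp add: numeral_2_eq_2)
    ultimately show ?thesis
      using 2(1) by (simp add: converse_rtrancl_into_rtrancl)
  qed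
qed simp

lemma language_dup_bta:
  assumes C: "bta_over \<Sigma> (dup_bta \<Sigma> B (term_code ` L))" and L: "L \<subseteq> ground_terms \<Sigma>"
    and \<Sigma>: "(1, 2) \<in> \<Sigma>"
  shows "language \<Sigma> (dup_bta \<Sigma> B (term_code ` L)) = descendants \<Sigma> dup_rules L"
proof (intro equalityI subsetI)
  fix t :: "(nat, nat) term"
  assume "t \<in> language \<Sigma> (dup_bta \<Sigma> B (term_code ` L))"
  then show "t \<in> descendants \<Sigma> dup_rules L"
    using L rtrancl_dup_rules_if_run_dup_bta[OF _ _ \<Sigma>]
    unfolding language_eq_run[OF C] descendants_def ground_terms_def by fastforce
next
  fix t
  assume "t \<in> descendants \<Sigma> dup_rules L"
  then obtain s where s: "s \<in> L" "(s, t) \<in> (rstep_over \<Sigma> dup_rules)\<^sup>*"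
    unfolding descendants_def by blast
  have "term_code s < B"
    using C s(1) by (auto simp: bta_over_def)
  then have "run (dup_bta \<Sigma> B (term_code ` L)) s (term_code s)"
    using L s(1) by (intro run_dup_bta_term_code) auto
  with s(2) have "run (dup_bta \<Sigma> B (term_code ` L)) t (term_code s)"
    by (induction rule: rtrancl_induct) (auto simp: rstep_over_def intro: run_dup_bta_rstep)
  then show "t \<in> language \<Sigma> (dup_bta \<Sigma> B (term_code ` L))"
    unfolding language_eq_run[OF C]
    using s L ground_terms_rtrancl_dup_rules[OF s(2)] by auto
qed


section \<open>Computability of the automata\<close>

text \<open>Exceeds the code of every transition. In the first kind the target below
  \<open>B\<close> already bounds the code of the left-hand side; in the second,
  \<open>p < B\<close> and monotonicity of the coding apply.\<close>

definition dup_trans_bound :: "nat \<Rightarrow> nat" where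
  "dup_trans_bound B = Suc (prod_encode (prod_encode (1, list_encode [B, B]), B))"

text \<open>Membership in \<open>dup_trans\<close> read off from codes: \<open>A\<close> codes the
  alphabet, \<open>m\<close> the pair of symbol and argument states, and \<open>q\<close> is the
  target.\<close>

definition is_dup_trans_code :: "nat \<Rightarrow> nat \<Rightarrow> nat \<Rightarrow> bool" where
  "is_dup_trans_code A B n \<longleftrightarrow>
     (let m = fst (prod_decode n); q = snd (prod_decode n) in
      Suc q \<le> B \<and>
      (q = Suc (2 * m) \<and>
         prod_encode (fst (prod_decode m), length (list_decode (snd (prod_decode m)))) \<in> set_decode A \<or>
       (\<exists>p<B. m = prod_encode (1, list_encode [p, p]) \<and>
         q = Suc (2 * prod_encode (0, list_encode [p])))))"

text \<open>The second component, the code of the final states, is \<open>B\<close> itself, because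
  \<open>B\<close> will be \<open>language_code L\<close>, the set code of the term codes of
  \<open>L\<close>. The last component 0 codes the empty set of \<open>eps\<close> rules.\<close>

definition dup_bta_code :: "nat \<Rightarrow> nat \<Rightarrow> nat" where
  "dup_bta_code A B = prod_encode (set_encode {..<B}, prod_encode (B,
     prod_encode (set_encode {n. n < dup_trans_bound B \<and> is_dup_trans_code A B n}, 0)))"

lemma computable_dup_bta_code: "computable 2 (\<lambda>xs. dup_bta_code (xs ! 0) (xs ! 1))"
  unfolding dup_bta_code_def is_dup_trans_code_def dup_trans_bound_def Let_def
    list_encode.simps
  by (intro computable_prod_encode computable_set_encode
      computable_set_encode_lessThan computable_conj computable_disj
      computable_bex computable_eq computable_le computable_mem_set_decode computable_Suc
      computable_mult computable_length_list_decode computable_fst_prod_decode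
      computable_snd_prod_decode computable_nth computable_nth_tl computable_nth_tl_tl
      computable_const) simp_all

lemma prod_encode_mono:
  assumes "a \<le> a'" and "b \<le> b'"
  shows "prod_encode (a, b) \<le> prod_encode (a', b')"
  using assms unfolding prod_encode_def triangle_def prod.case
  by (intro add_mono div_le_mono mult_le_mono) auto

lemma mem_prod_encode_image_iff: "prod_encode x \<in> prod_encode ` A \<longleftrightarrow> x \<in> A"
  using inj_prod_encode by (auto dest: injD)

lemma trans_code_dup_trans:
  assumes "finite \<Sigma>"
  shows "trans_code ` dup_trans \<Sigma> B =
    {n. n < dup_trans_bound B \<and> is_dup_trans_code (alphabet_code \<Sigma>) B n}"
proof -
  have mem: "(f, qs, q) \<in> dup_trans \<Sigma> B \<longleftrightarrow>
      is_dup_trans_code (alphabet_code \<Sigma>) B (trans_code (f, qs, q))" for f qs q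
    using assms
    by (auto simp: dup_trans_def is_dup_trans_code_def trans_code_def alphabet_code_def
        mem_prod_encode_image_iff prod_encode_eq list_encode_eq[of _ "[_, _]", simplified] Suc_le_eq)
  have bound: "trans_code (f, qs, q) < dup_trans_bound B" if "(f, qs, q) \<in> dup_trans \<Sigma> B" for f qs q
  proof -
    have "prod_encode (f, list_encode qs) \<le> prod_encode (1, list_encode [B, B])"
      using that unfolding dup_trans_def
    proof (safe, goal_cases)
      case 1
      then have "prod_encode (f, list_encode qs) \<le> B"
        by simp
      also have "B \<le> list_encode [B, B]"
        using less_list_encode[of B "[B, B]"] by simp
      also have "\<dots> \<le> prod_encode (1, list_encode [B, B])"
        by (rule le_prod_encode_2)
      finally show ?case .
    next
      case (2 p)
      then show ?case
        by (auto intro!: prod_encode_mono)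
    qed
    moreover have "q \<le> B"
      using that by (auto simp: dup_trans_def)
    ultimately show ?thesis
      using prod_encode_mono by (simp add: trans_code_def dup_trans_bound_def less_Suc_eq_le)
  qed
  \<comment> \<open>Every number codes some triple, so no number satisfying the arithmetic condition
    falls outside the image.\<close>
  have "\<exists>f qs q. n = trans_code (f, qs, q)" for n
    unfolding trans_code_def prod.case by (metis prod_decode_inverse list_decode_inverse surj_pair)
  then show ?thesis
    using mem bound by (fastforce simp: image_iff)
qed

lemma bta_over_dup_bta:
  assumes "finite \<Sigma>" and "(1, 2) \<in> \<Sigma>" and "Q \<subseteq> {..<B}"
  shows "bta_over \<Sigma> (dup_bta \<Sigma> B Q)"
proof -
  \<comment> \<open>Finiteness of the transitions is inherited from their codes, which are
    bounded.\<close>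
  have "inj trans_code"
    by (auto simp: inj_def trans_code_def prod_encode_eq list_encode_eq)
  moreover have "finite (trans_code ` dup_trans \<Sigma> B)"
    unfolding trans_code_dup_trans[OF assms(1)] by simp
  ultimately have "finite (dup_trans \<Sigma> B)"
    using finite_imageD inj_on_subset by blast
  moreover have "(f, length qs) \<in> \<Sigma> \<and> set qs \<subseteq> {..<B} \<and> q < B" if "(f, qs, q) \<in> dup_trans \<Sigma> B" for f qs q
    using that assms(2) less_node_code[of _ qs f]
    by (force simp: dup_trans_def numeral_2_eq_2)
  ultimately show ?thesis
    using assms(3) by (auto simp: bta_over_def)
qed

lemma EPRF_trs_dup_rules: "EPRF_trs dup_rules"
proof -
  obtain F where F: "\<And>A B. rec_computes F [A, B] (dup_bta_code A B)"
    using computable_dup_bta_code unfolding computable_def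
    by (metis One_nat_def length_Cons list.size(3) nth_Cons_0 nth_Cons_Suc numeral_2_eq_2)
  show ?thesis
    unfolding EPRF_trs_def
  proof (intro exI[of _ F] allI impI)
    fix \<Sigma> and L :: "(nat, nat) term set"
    assume *: "ranked_alphabet \<Sigma> \<and> sign dup_rules \<subseteq> \<Sigma> \<and> finite L \<and> L \<subseteq> ground_terms \<Sigma>"
    let ?B = "language_code L"
    let ?C = "dup_bta \<Sigma> ?B (term_code ` L)"
    have fin: "finite \<Sigma>" "finite (term_code ` L)"
      using * by (auto simp: ranked_alphabet_def)
    have \<Sigma>: "(1, 2) \<in> \<Sigma>"
      using * by (auto simp: sign_def dup_rules_def numeral_2_eq_2)
    \<comment> \<open>The number \<open>language_code L\<close> also works as the bound on states:
      it is a sum of powers of two containing \<open>2 ^ term_code t\<close>, which exceeds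
      \<open>term_code t\<close>.\<close>
    have "term_code t < ?B" if "t \<in> L" for t
    proof -
      have "term_code t < 2 ^ term_code t"
        by (rule less_exp)
      also have "\<dots> \<le> ?B"
        unfolding language_code_def set_encode_def using fin(2) that by (intro member_le_sum) auto
      finally show ?thesis .
    qed
    then have C: "bta_over \<Sigma> ?C"
      using fin(1) \<Sigma> by (intro bta_over_dup_bta) auto
    have "trans_code ` trans ?C =
        {n. n < dup_trans_bound ?B \<and> is_dup_trans_code (alphabet_code \<Sigma>) ?B n}"
      using fin(1) by (simp add: trans_code_dup_trans)
    then have "bta_code ?C = dup_bta_code (alphabet_code \<Sigma>) ?B"
      by (simp add: bta_code_def dup_bta_code_def language_code_def)
    then show "\<exists>C. rec_computes F [alphabet_code \<Sigma>, language_code L] (bta_code C) \<and>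
        bta_over \<Sigma> C \<and> language \<Sigma> C = descendants \<Sigma> dup_rules L"
      using F C language_dup_bta[OF C] * \<Sigma> by metis
  qed
qed

theorem mainTheorem14:
  "\<exists>(\<Sigma> :: (nat \<times> nat) set) (R :: (nat, nat) rules).
     ranked_alphabet \<Sigma> \<and> trs \<Sigma> R \<and> left_linear R \<and> monadic R \<and>
     EPRF_trs R \<and> \<not> PSR_trs \<Sigma> R"
proof (intro exI conjI)
  show "ranked_alphabet tower_alphabet"
    by (auto simp: ranked_alphabet_def tower_alphabet_def single_valued_def)
  show "trs tower_alphabet dup_rules"
    by (auto simp: trs_def dup_rules_def tower_alphabet_def Fun_mem_terms_iff intro: terms.intros)
  show "left_linear dup_rules"
    by (simp add: left_linear_def dup_rules_def)
  show "monadic dup_rules"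
    by (simp add: monadic_def dup_rules_def)
qed (rule EPRF_trs_dup_rules not_PSR_trs_dup_rules)+

end
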